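(* For the matrix-valued polynomial minimax approximation ($d=0$), with the iteration m-d-Lawson and the function $\nu$ as described in the context, we have: (i) the function $\nu(\beta)$ is convex; (ii) $\beta=1$ is the global minimizer of $\min_{\beta\ge0}\big(\gamma_\beta^{(k)}\zeta_\beta^{(k)}\big)^2$. In this sense, $\beta=1$ achieves the maximum of the lower bound in $$\sqrt{d(\boldsymbol w^{(k+1)})}\ \ge\ d(\boldsymbol w^{(k)})\,\frac{1}{\gamma_\beta^{(k)}\zeta_\beta^{(k)}}$$ and can be viewed as the near-optimal Lawson exponent for m-d-Lawson; (iii) for all $\beta\in[0,2]$, the sequence $\{d(\boldsymbol w^{(k)})\}_k$ of m-d-Lawson satisfies $d(\boldsymbol w^{(k+1)})\ge d(\boldsymbol w^{(k)})$.
   Context: $s,t\ge1$ and $n_{ij}\ge0$ ($1\le i\le s$, $1\le j\le t$) are prescribed integers; $\mathbb P_n$ is the set of complex polynomials of degree at most $n$; $x_1,\dots,x_m\in\mathbb C$ are distinct nodes with $m\ge\max_{i,j}\{n_{ij}+2\}$; $F(x_\ell)=[f_{ij}(x_\ell)]\in\mathbb C^{s\times t}$ are given data; $\|\cdot\|_{\mathrm F}$ is the Frobenius norm. The problem is to minimize $\max_{1\le\ell\le m}\|F(x_\ell)-P(x_\ell)\|_{\mathrm F}^2$ over matrix-valued polynomials $P=[p_{ij}]$ with $p_{ij}\in\mathbb P_{n_{ij}}$; this is the case $d=0$ of rational approximation by $[p_{ij}/q]$ with a common denominator $q$ of degree at most $d$, so that $q\equiv1$. Let $\mathcal S=\{\boldsymbol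 w\in\mathbb R^m:\boldsymbol w\ge0,\ \sum_\ell w_\ell=1\}$. For $\boldsymbol w\in\mathcal S$ the dual function is, with $q\equiv1$, $$d(\boldsymbol w)=\min_{p_{ij}\in\mathbb P_{n_{ij}}}\sum_{\ell=1}^m w_\ell\sum_{i=1}^s\sum_{j=1}^t|f_{ij}(x_\ell)-p_{ij}(x_\ell)|^2 .$$ Iteration m-d-Lawson with Lawson exponent $\beta$ (no nodes with positive weight are filtered out): start from $\boldsymbol w^{(0)}\in\mathcal S$ with all entries positive. At step $k$, let $P^{(k)}=[p^{(k)}_{ij}]$ attain $d(\boldsymbol w^{(k)})$, put $\tau_\ell^{(k)}=\|F(x_\ell)-P^{(k)}(x_\ell)\|_{\mathrm F}$, and update $$w_\ell^{(k+1)}=\frac{w_\ell^{(k)}(\tau_\ell^{(k)})^\beta}{\gamma_\beta^{(k)}},\quad 1\le\ell\le m,\qquad \gamma_\beta^{(k)}=\sum_{\ell=1}^m w_\ell^{(k)}(\tau_\ell^{(k)})^\beta=\sum_{\ell\in\mathcal J}w_\ell^{(k)}(\tau_\ell^{(k)})^\beta,$$ where $\mathcal J=\{\ell:\ w^{(k+1)}_\ell\ne0\}=\{\ell:\ w^{(k)}_\ell\tau^{(k)}_\ell\ne0\}$. It is assumed that $d(\boldsymbol w^{(k)})>0$ and that, for every $k\ge0$, the number of indices $\ell$ with $w_\ell^{(k)}\ne0$ is at least $\max\{1,\max_{i,j}(n_{ij}+1)\}$. With the convention $0\cdot\frac00=0$, define $\zeta_\beta^{(k)}\ge0$ by $$\big(\zeta_\beta^{(k)}\big)^2=\sum_{\ell=1}^m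 w_\ell^{(k+1)}\,\frac{\sum_{i=1}^s\sum_{j=1}^t|f_{ij}(x_\ell)-p_{ij}^{(k)}(x_\ell)|^2}{(\tau_\ell^{(k)})^{2\beta}},$$ and $$\nu(\beta):=\big(\gamma_\beta^{(k)}\zeta_\beta^{(k)}\big)^2=\Big(\sum_{\ell\in\mathcal J}w^{(k)}_\ell(\tau^{(k)}_\ell)^\beta\Big)\Big(\sum_{\ell\in\mathcal J}w^{(k)}_\ell(\tau^{(k)}_\ell)^{2-\beta}\Big).$$ A near-optimal Lawson exponent is defined as $\beta_*^{(k)}=\arg\min_{\beta\ge0}\big(\gamma_\beta^{(k)}\zeta_\beta^{(k)}\big)^2$. *)

theory Defs
  imports "HOL-Analysis.Analysis" "HOL-Computational_Algebra.Polynomial"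
begin

text \<open>
  The numbers of rows, columns and nodes are the cardinalities of the index types \<open>'s\<close>, \<open>'t\<close>
  and \<open>'m\<close>; the degree bounds are a function \<open>n\<close> of the row and column index. Only the values
  of \<open>F\<close> at the nodes \<open>x l\<close> are ever used.

  On \<open>complex^'t^'s\<close> the library norm is the Frobenius norm.
\<close>

lemma norm_eq_Frobenius:
  fixes A :: "complex^'t^'s"
  shows "norm A = sqrt (\<Sum>i\<in>UNIV. \<Sum>j\<in>UNIV. (cmod (A $ i $ j))\<^sup>2)"
  by (simp add: norm_vec_def L2_set_def sum_nonneg)

definition poly_matrices :: "('s \<Rightarrow> 't \<Rightarrow> nat) \<Rightarrow> (complex poly^'t^'s) set" where
  "poly_matrices n = {P. \<forall>i j. degree (P $ i $ j) \<le> n i j}"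

definition eval_mat :: "complex poly^'t^'s \<Rightarrow> complex \<Rightarrow> complex^'t^'s" where
  "eval_mat P z = (\<chi> i j. poly (P $ i $ j) z)"

definition simplex_weights :: "(real^'m) set" where
  "simplex_weights = {w. (\<forall>l. 0 \<le> w $ l) \<and> (\<Sum>l\<in>UNIV. w $ l) = 1}"

definition sq_err ::
    "('m \<Rightarrow> complex) \<Rightarrow> (complex \<Rightarrow> complex^'t^'s) \<Rightarrow> complex poly^'t^'s \<Rightarrow> 'm \<Rightarrow> real" where
  "sq_err x F P l = (\<Sum>i\<in>UNIV. \<Sum>j\<in>UNIV. (cmod (F (x l) $ i $ j - poly (P $ i $ j) (x l)))\<^sup>2)"

definition weighted_err ::
    "('m \<Rightarrow> complex) \<Rightarrow> (complex \<Rightarrow> complex^'t^'s) \<Rightarrow> real^'m \<Rightarrow> complex poly^'t^'s \<Rightarrow> real" where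
  "weighted_err x F w P = (\<Sum>l\<in>UNIV. w $ l * sq_err x F P l)"

text \<open>The infimum is a minimum for nonnegative weights, see \<open>dual_fun_attained\<close> below.\<close>

definition dual_fun ::
    "('m \<Rightarrow> complex) \<Rightarrow> (complex \<Rightarrow> complex^'t^'s) \<Rightarrow> ('s \<Rightarrow> 't \<Rightarrow> nat) \<Rightarrow> real^'m \<Rightarrow> real" where
  "dual_fun x F n w = (INF P\<in>poly_matrices n. weighted_err x F w P)"

definition attains_dual ::
    "('m \<Rightarrow> complex) \<Rightarrow> (complex \<Rightarrow> complex^'t^'s) \<Rightarrow> ('s \<Rightarrow> 't \<Rightarrow> nat) \<Rightarrow> real^'m
      \<Rightarrow> complex poly^'t^'s \<Rightarrow> bool" where
  "attains_dual x F n w P \<longleftrightarrow> P \<in> poly_matrices n \<and> weighted_err x F w P = dual_fun x F n w"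

definition resid ::
    "('m \<Rightarrow> complex) \<Rightarrow> (complex \<Rightarrow> complex^'t^'s) \<Rightarrow> complex poly^'t^'s \<Rightarrow> 'm \<Rightarrow> real" where
  "resid x F P l = norm (F (x l) - eval_mat P (x l))"

text \<open>
  In \<open>lawson_gamma\<close>, \<open>lawson_step\<close> and \<open>lawson_zeta\<close>, \<open>w\<close> and \<open>P\<close> are the weights and the
  least-squares solution of the current step. As \<open>0 powr b = 0\<close> for all \<open>b\<close>, including \<open>b = 0\<close>,
  the support of the updated weights is the set of nodes where both weight and residual are
  nonzero, whatever the exponent. As \<open>0 / 0 = 0\<close>, the terms of \<open>lawson_zeta\<close> with zero residual
  vanish.
\<close>

definition lawson_gamma ::
    "('m \<Rightarrow> complex) \<Rightarrow> (complex \<Rightarrow> complex^'t^'s) \<Rightarrow> real^'m \<Rightarrow> complex poly^'t^'s \<Rightarrow> real \<Rightarrow> real" where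
  "lawson_gamma x F w P \<beta> = (\<Sum>l\<in>UNIV. w $ l * resid x F P l powr \<beta>)"

definition lawson_step ::
    "('m \<Rightarrow> complex) \<Rightarrow> (complex \<Rightarrow> complex^'t^'s) \<Rightarrow> real^'m \<Rightarrow> complex poly^'t^'s \<Rightarrow> real \<Rightarrow> real^'m" where
  "lawson_step x F w P \<beta> = (\<chi> l. w $ l * resid x F P l powr \<beta> / lawson_gamma x F w P \<beta>)"

definition lawson_zeta ::
    "('m \<Rightarrow> complex) \<Rightarrow> (complex \<Rightarrow> complex^'t^'s) \<Rightarrow> real^'m \<Rightarrow> complex poly^'t^'s \<Rightarrow> real \<Rightarrow> real" where
  "lawson_zeta x F w P \<beta> =
     sqrt (\<Sum>l\<in>UNIV. lawson_step x F w P \<beta> $ l * (sq_err x F P l / resid x F P l powr (2 * \<beta>)))"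

definition lawson_nu ::
    "('m \<Rightarrow> complex) \<Rightarrow> (complex \<Rightarrow> complex^'t^'s) \<Rightarrow> real^'m \<Rightarrow> complex poly^'t^'s \<Rightarrow> real \<Rightarrow> real" where
  "lawson_nu x F w P \<beta> = (lawson_gamma x F w P \<beta> * lawson_zeta x F w P \<beta>)\<^sup>2"

text \<open>
  A run of m-d-Lawson with exponent \<open>\<beta>\<close>: weights \<open>w k\<close> and polynomial matrices \<open>P k\<close>. The
  minimizer \<open>P k\<close> need not be unique, any choice is allowed.
\<close>

definition mdLawson_run ::
    "('m \<Rightarrow> complex) \<Rightarrow> (complex \<Rightarrow> complex^'t^'s) \<Rightarrow> ('s \<Rightarrow> 't \<Rightarrow> nat) \<Rightarrow> real
      \<Rightarrow> (nat \<Rightarrow> real^'m) \<Rightarrow> (nat \<Rightarrow> complex poly^'t^'s) \<Rightarrow> bool" where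
  "mdLawson_run x F n \<beta> w P \<longleftrightarrow>
     w 0 \<in> simplex_weights \<and> (\<forall>l. 0 < w 0 $ l) \<and>
     (\<forall>k. attains_dual x F n (w k) (P k) \<and> w (Suc k) = lawson_step x F (w k) (P k) \<beta>)"

lemma sq_err_eq: "sq_err x F P l = (resid x F P l)\<^sup>2"
  by (simp add: sq_err_def resid_def norm_eq_Frobenius eval_mat_def sum_nonneg)

lemma lawson_nu_eq:
  fixes x :: "'m::finite \<Rightarrow> complex" and F :: "complex \<Rightarrow> complex^'t^'s"
    and w :: "real^'m" and P :: "complex poly^'t^'s"
  assumes "\<And>l. 0 \<le> w $ l"
  defines "J \<equiv> {l. w $ l * resid x F P l \<noteq> 0}"
  shows "lawson_nu x F w P \<beta> =
    (\<Sum>l\<in>J. w $ l * resid x F P l powr \<beta>) * (\<Sum>l\<in>J. w $ l * resid x F P l powr (2 - \<beta>))"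
proof -
  let ?r = "resid x F P" and ?g = "lawson_gamma x F w P \<beta>"
  have J: "(\<Sum>l\<in>J. w $ l * ?r l powr b) = (\<Sum>l\<in>UNIV. w $ l * ?r l powr b)" for b
    by (rule sum.mono_neutral_left) (auto simp: J_def)
  have g: "?g \<ge> 0"
    unfolding lawson_gamma_def by (intro sum_nonneg mult_nonneg_nonneg assms) auto
  have term_eq: "lawson_step x F w P \<beta> $ l * (sq_err x F P l / ?r l powr (2 * \<beta>)) =
      w $ l * ?r l powr (2 - \<beta>) / ?g" for l
  proof (cases "?r l = 0")
    case False
    then have "?r l > 0" by (simp add: resid_def)
    then have "?r l powr \<beta> * ((?r l)\<^sup>2 / ?r l powr (2 * \<beta>)) = ?r l powr (2 - \<beta>)"
      by (simp flip: powr_numeral powr_add powr_diff)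
    then have "w $ l / ?g * (?r l powr \<beta> * ((?r l)\<^sup>2 / ?r l powr (2 * \<beta>))) =
        w $ l / ?g * ?r l powr (2 - \<beta>)" by (rule arg_cong)
    then show ?thesis by (simp add: lawson_step_def sq_err_eq mult.assoc)
  qed (simp add: lawson_step_def)
  have "(lawson_zeta x F w P \<beta>)\<^sup>2 = (\<Sum>l\<in>UNIV. w $ l * ?r l powr (2 - \<beta>)) / ?g"
    unfolding lawson_zeta_def term_eq
    using g by (subst real_sqrt_pow2) (auto intro!: sum_nonneg divide_nonneg_nonneg mult_nonneg_nonneg assms simp: sum_divide_distrib)
  then show ?thesis
    unfolding lawson_nu_def power_mult_distrib J by (simp add: power2_eq_square flip: lawson_gamma_def)
qed

lemma dual_fun_attained:
  fixes x :: "'m::finite \<Rightarrow> complex" and F :: "complex \<Rightarrow> complex^'t^'s" and w :: "real^'m"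
  assumes w: "\<And>l. 0 \<le> w $ l"
  obtains P where "attains_dual x F n w P"
proof -
  define E :: "complex poly^'t^'s \<Rightarrow> complex^'t^'s^'m" where
    "E P = (\<chi> l. sqrt (w $ l) *\<^sub>R eval_mat P (x l))" for P
  define G :: "complex^'t^'s^'m" where "G = (\<chi> l. sqrt (w $ l) *\<^sub>R F (x l))"
  have err: "weighted_err x F w P = (dist G (E P))\<^sup>2" for P
  proof -
    have "(dist G (E P))\<^sup>2 = (\<Sum>l\<in>UNIV. (norm (sqrt (w $ l) *\<^sub>R (F (x l) - eval_mat P (x l))))\<^sup>2)"
      unfolding dist_norm norm_vec_def[of "G - E P"] L2_set_def
      by (simp add: sum_nonneg G_def E_def scaleR_diff_right)
    also have "\<dots> = weighted_err x F w P"
      by (simp add: weighted_err_def sq_err_eq resid_def power_mult_distrib w)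
    finally show ?thesis ..
  qed
  have "subspace (E ` poly_matrices n)"
  proof (rule subspaceI)
    have "E 0 = 0" by (simp add: E_def eval_mat_def vec_eq_iff)
    moreover have "0 \<in> poly_matrices n" by (simp add: poly_matrices_def)
    ultimately show "0 \<in> E ` poly_matrices n" by (metis image_eqI)
  next
    fix u v assume "u \<in> E ` poly_matrices n" "v \<in> E ` poly_matrices n"
    then obtain P Q where "P \<in> poly_matrices n" "Q \<in> poly_matrices n" "u = E P" "v = E Q" by auto
    moreover from this have "P + Q \<in> poly_matrices n" "u + v = E (P + Q)"
      by (auto simp: poly_matrices_def degree_add_le E_def eval_mat_def vec_eq_iff algebra_simps)
    ultimately show "u + v \<in> E ` poly_matrices n" by blast
  next
    fix c u assume "u \<in> E ` poly_matrices n"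
    then obtain P where P: "P \<in> poly_matrices n" "u = E P" by auto
    define Q where "Q = (\<chi> i j. smult (of_real c) (P $ i $ j))"
    have "Q \<in> poly_matrices n" "c *\<^sub>R u = E Q"
      using P by (auto simp: Q_def poly_matrices_def E_def eval_mat_def vec_eq_iff scaleR_conv_of_real[where 'a = complex]
        intro: order_trans[OF degree_smult_le])
    then show "c *\<^sub>R u \<in> E ` poly_matrices n" by blast
  qed
  then have "closed (E ` poly_matrices n)" "E ` poly_matrices n \<noteq> {}"
    using closed_subspace subspace_0 by blast+
  then obtain P where P: "P \<in> poly_matrices n" "\<And>Q. Q \<in> poly_matrices n \<Longrightarrow> dist G (E P) \<le> dist G (E Q)"
    using distance_attains_inf[of "E ` poly_matrices n" G] by (metis (no_types, lifting) imageE imageI)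
  have "dual_fun x F n w = weighted_err x F w P"
    unfolding dual_fun_def
    by (rule cInf_eq_minimum) (use P in \<open>auto simp: err intro!: power_mono\<close>)
  then show thesis using that[of P] P(1) by (simp add: attains_dual_def)
qed

end

theory Submission imports Defs
begin

text \<open>
  With \<open>g(\<beta>) = \<Sum>\<^sub>l w\<^sub>l \<tau>\<^sub>l\<^sup>\<beta>\<close> one has \<open>\<nu>(\<beta>) = g(\<beta>) g(2 - \<beta>)\<close>. Multiplied out, this is a nonnegative
  combination of exponentials in \<open>\<beta>\<close>, hence convex; it is symmetric about \<open>\<beta> = 1\<close>, so \<open>1\<close> is its
  minimizer. The least-squares optimality of \<open>P\<close> makes the residual \<open>F - P\<close> orthogonal to all
  differences \<open>Q - P\<close>, so that \<open>d(w) = \<Sum>\<^sub>l w\<^sub>l \<langle>F - P, F - Q\<rangle>\<close>, and the Cauchy-Schwarz inequality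
  bounds \<open>d(w)\<^sup>2\<close> by \<open>\<nu>(\<beta>)\<close> times the error of \<open>Q\<close> for the updated weights. On \<open>[0, 2]\<close>, convexity and
  symmetry give \<open>\<nu>(\<beta>) \<le> \<nu>(0) = g(0) g(2) \<le> d(w)\<close>, whence monotonicity.
\<close>

section \<open>Convexity of exponential sums\<close>

lemma convex_on_exp_affine: "convex_on UNIV (\<lambda>b::real. exp (a * b + c))"
  by (rule f''_ge0_imp_convex[where f' = "\<lambda>b. a * exp (a * b + c)"
        and f'' = "\<lambda>b. a * (a * exp (a * b + c))"])
     (auto intro!: derivative_eq_intros simp: mult.assoc[symmetric])

text \<open>For positive bases this is the exponential of an affine function of \<open>b\<close>. A
  zero base gives the zero function: \<open>0 powr 0 = 0\<close>, so there is no jump at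
  \<open>b = 0\<close> or \<open>b = 2\<close>.\<close>

lemma convex_on_powr_mult_powr:
  fixes r s :: real
  assumes "r \<ge> 0" "s \<ge> 0"
  shows "convex_on UNIV (\<lambda>b. r powr b * s powr (2 - b))"
proof (cases "r = 0 \<or> s = 0")
  case True
  then show ?thesis by (auto simp: convex_on_def)
next
  case False
  then have "(\<lambda>b. r powr b * s powr (2 - b)) = (\<lambda>b. exp ((ln r - ln s) * b + 2 * ln s))"
    by (auto simp: powr_def algebra_simps simp flip: exp_add)
  then show ?thesis using convex_on_exp_affine by simp
qed

lemma convex_on_sum_functions:
  fixes f :: "'a \<Rightarrow> 'b::real_vector \<Rightarrow> real"
  assumes "convex A" "\<And>i. i \<in> S \<Longrightarrow> convex_on A (f i)"
  shows "convex_on A (\<lambda>b. \<Sum>i\<in>S. f i b)"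
  using assms by (induction S rule: infinite_finite_induct) (auto simp: convex_on_const)

section \<open>Symmetry and convexity of \<open>lawson_nu\<close>\<close>

lemma resid_nonneg: "0 \<le> resid x F P l"
  by (simp add: resid_def)

lemma weighted_err_eq_gamma: "weighted_err x F w P = lawson_gamma x F w P 2"
  by (simp add: weighted_err_def lawson_gamma_def sq_err_eq resid_nonneg)

lemma lawson_nu_eq_gamma:
  assumes "\<And>l. 0 \<le> w $ l"
  shows "lawson_nu x F w P b = lawson_gamma x F w P b * lawson_gamma x F w P (2 - b)"
proof -
  have "(\<Sum>l\<in>{l. w $ l * resid x F P l \<noteq> 0}. w $ l * resid x F P l powr c) =
      lawson_gamma x F w P c" for c
    unfolding lawson_gamma_def by (rule sum.mono_neutral_left) auto
  then show ?thesis by (simp only: lawson_nu_eq[OF assms])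
qed

lemma lawson_nu_reflect:
  assumes "\<And>l. 0 \<le> w $ l"
  shows "lawson_nu x F w P (2 - b) = lawson_nu x F w P b"
  by (simp add: lawson_nu_eq_gamma[OF assms] mult.commute)

lemma lawson_gamma_nonneg:
  assumes "\<And>l. 0 \<le> w $ l"
  shows "0 \<le> lawson_gamma x F w P b"
  unfolding lawson_gamma_def by (intro sum_nonneg mult_nonneg_nonneg assms) simp

text \<open>A product of convex functions need not be convex, so the two sums are multiplied out
  first; convexity then holds term by term.\<close>

lemma convex_on_lawson_nu:
  assumes w: "\<And>l. 0 \<le> w $ l"
  shows "convex_on UNIV (lawson_nu x F w P)"
proof -
  let ?r = "resid x F P"
  have "lawson_nu x F w P = (\<lambda>b. \<Sum>l\<in>UNIV. \<Sum>l'\<in>UNIV.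
      (w $ l * w $ l') * (?r l powr b * ?r l' powr (2 - b)))"
    by (simp add: fun_eq_iff lawson_nu_eq_gamma[OF w] lawson_gamma_def sum_product mult_ac)
  then show ?thesis
    by (simp add: convex_on_sum_functions convex_on_cmul convex_on_powr_mult_powr w resid_nonneg)
qed

text \<open>The point 1 is the midpoint of \<open>b\<close> and \<open>2 - b\<close>, where the
  values agree; midpoint convexity suffices.\<close>

lemma lawson_nu_minimal:
  assumes w: "\<And>l. 0 \<le> w $ l"
  shows "lawson_nu x F w P 1 \<le> lawson_nu x F w P b"
  using convex_onD[OF convex_on_lawson_nu[OF w], of "1/2" b "2 - b" x F P] lawson_nu_reflect[OF w, of x F P b]
  by (simp add: field_simps)

text \<open>Here \<open>b\<close> is the convex combination of 0 and 2 with weight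
  \<open>b/2\<close> on 2, and the values at both endpoints agree.\<close>

lemma lawson_nu_le_endpoint:
  assumes w: "\<And>l. 0 \<le> w $ l" and b: "b \<in> {0..2}"
  shows "lawson_nu x F w P b \<le> lawson_nu x F w P 0"
  using convex_onD[OF convex_on_lawson_nu[OF w], of "b/2" 0 2 x F P] lawson_nu_reflect[OF w, of x F P 0] b
  by (simp add: field_simps)

section \<open>First-order optimality of the least-squares solution\<close>

lemma attains_dual_variational:
  fixes x :: "'m::finite \<Rightarrow> complex" and F :: "complex \<Rightarrow> complex^'t::finite^'s::finite"
  assumes w: "\<And>l. 0 \<le> w $ l" and P: "attains_dual x F n w P" and Q: "Q \<in> poly_matrices n"
  shows "dual_fun x F n w
    \<le> (\<Sum>l\<in>UNIV. w $ l * ((F (x l) - eval_mat P (x l)) \<bullet> (F (x l) - eval_mat Q (x l))))"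
proof -
  define E where "E l = F (x l) - eval_mat P (x l)" for l
  define D where "D l = eval_mat Q (x l) - eval_mat P (x l)" for l
  define A where "A = (\<Sum>l\<in>UNIV. w $ l * (E l \<bullet> E l))"
  define B where "B = (\<Sum>l\<in>UNIV. w $ l * (D l \<bullet> D l))"
  define c where "c = (\<Sum>l\<in>UNIV. w $ l * (E l \<bullet> D l))"
  have dual: "dual_fun x F n w = A"
    using P by (simp add: attains_dual_def weighted_err_def sq_err_eq resid_def A_def E_def
        power2_norm_eq_inner)
  \<comment> \<open>Compare \<open>P\<close> with \<open>P + s (Q - P)\<close>, again admissible:
    the error there is \<open>A - 2 s c + s^2 B\<close> and cannot drop below \<open>A\<close>. Only
    \<open>c \<le> 0\<close> is extracted from this, which yields the inequality half of
    orthogonality.\<close>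
  have quad: "2 * s * c \<le> s\<^sup>2 * B" for s
  proof -
    define R where "R = (\<chi> i j. P $ i $ j + smult (of_real s) (Q $ i $ j - P $ i $ j))"
    have "R \<in> poly_matrices n"
      using P Q by (auto simp: R_def poly_matrices_def attains_dual_def
          intro!: degree_add_le order_trans[OF degree_smult_le] degree_diff_le)
    then have "dual_fun x F n w \<le> weighted_err x F w R"
      unfolding dual_fun_def
      by (intro cINF_lower bdd_belowI2[of _ 0])
         (auto simp: weighted_err_def sq_err_eq w intro!: sum_nonneg mult_nonneg_nonneg)
    also have "weighted_err x F w R
        = (\<Sum>l\<in>UNIV. w $ l * ((E l - s *\<^sub>R D l) \<bullet> (E l - s *\<^sub>R D l)))"
    proof -
      have "F (x l) - eval_mat R (x l) = E l - s *\<^sub>R D l" for l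
        by (simp add: R_def E_def D_def eval_mat_def vec_eq_iff
            scaleR_conv_of_real[where 'a = complex])
      then show ?thesis
        by (simp add: weighted_err_def sq_err_eq resid_def power2_norm_eq_inner)
    qed
    also have "\<dots> = (\<Sum>l\<in>UNIV. w $ l * (E l \<bullet> E l) - 2 * s * (w $ l * (E l \<bullet> D l))
        + s\<^sup>2 * (w $ l * (D l \<bullet> D l)))"
      by (intro sum.cong refl)
         (simp add: inner_diff_left inner_diff_right inner_commute power2_eq_square algebra_simps)
    also have "\<dots> = A - 2 * s * c + s\<^sup>2 * B"
      by (simp only: A_def B_def c_def sum.distrib sum_subtractf sum_distrib_left)
    finally show ?thesis using dual by simp
  qed
  have B: "B \<ge> 0" unfolding B_def by (intro sum_nonneg mult_nonneg_nonneg w) simp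
  have "c \<le> 0"
  proof (rule ccontr)
    assume "\<not> c \<le> 0"
    then have "c > 0" by simp
    \<comment> \<open>For small \<open>s > 0\<close> the linear term dominates. The
      \<open>+ 1\<close> covers \<open>B = 0\<close> and gives \<open>s B = c - s < 2 c\<close>,
      against \<open>2 c \<le> s B\<close>.\<close>
    define s where "s = c / (B + 1)"
    have s: "s > 0" "s * (B + 1) = c" using B \<open>c > 0\<close> by (simp_all add: s_def)
    have "s * (2 * c) \<le> s * (s * B)"
      using quad[of s] by (simp add: power2_eq_square mult_ac)
    then have "2 * c \<le> s * B" using s(1) by simp
    then show False using s \<open>c > 0\<close> by (simp add: distrib_left)
  qed
  moreover have "F (x l) - eval_mat Q (x l) = E l - D l" for l
    by (simp add: E_def D_def)
  then have "(\<Sum>l\<in>UNIV. w $ l * (E l \<bullet> (F (x l) - eval_mat Q (x l)))) = A - c"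
    by (simp add: A_def c_def inner_diff_right right_diff_distrib sum_subtractf)
  ultimately show ?thesis using dual by (simp add: E_def)
qed

section \<open>Effect of one Lawson step on the dual value\<close>

lemma lawson_step_nonneg:
  assumes "\<And>l. 0 \<le> w $ l"
  shows "0 \<le> lawson_step x F w P b $ l"
  by (simp add: lawson_step_def assms lawson_gamma_nonneg[OF assms])

text \<open>A positive dual value forces a node with nonzero weight and residual; its term is
  positive for every exponent.\<close>

lemma lawson_gamma_pos:
  assumes w: "\<And>l. 0 \<le> w $ l" and P: "attains_dual x F n w P" and d: "dual_fun x F n w > 0"
  shows "lawson_gamma x F w P b > 0"
proof -
  have "(\<Sum>l\<in>UNIV. w $ l * sq_err x F P l) > 0"
    using P d by (simp add: attains_dual_def weighted_err_def)
  then obtain l where "w $ l * sq_err x F P l \<noteq> 0"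
    by (metis (no_types, lifting) sum.not_neutral_contains_not_neutral less_irrefl)
  then have "w $ l * resid x F P l powr b > 0"
    using w[of l] by (auto simp: sq_err_eq less_le)
  then show ?thesis
    unfolding lawson_gamma_def by (intro sum_pos2[of _ l]) (auto intro!: mult_nonneg_nonneg w)
qed

lemma lawson_step_simplex:
  assumes w: "\<And>l. 0 \<le> w $ l" and g: "lawson_gamma x F w P b > 0"
  shows "lawson_step x F w P b \<in> simplex_weights"
  using g lawson_step_nonneg[OF w]
  by (auto simp: simplex_weights_def lawson_step_def lawson_gamma_def simp flip: sum_divide_distrib)

lemma dual_fun_step_bound:
  fixes x :: "'m::finite \<Rightarrow> complex" and F :: "complex \<Rightarrow> complex^'t::finite^'s::finite"
  assumes w: "\<And>l. 0 \<le> w $ l" and P: "attains_dual x F n w P" and d: "dual_fun x F n w > 0"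
  shows "(dual_fun x F n w)\<^sup>2 \<le> lawson_nu x F w P b * dual_fun x F n (lawson_step x F w P b)"
proof -
  let ?r = "resid x F P" and ?g = "lawson_gamma x F w P" and ?w' = "lawson_step x F w P b"
  obtain Q where Q: "attains_dual x F n ?w' Q"
    using dual_fun_attained[of ?w'] lawson_step_nonneg[OF w] by metis
  let ?q = "resid x F Q"
  \<comment> \<open>Split the residual as \<open>r = r^((2-b)/2) * r^(b/2)\<close>: the squares of
    \<open>u\<close> sum to the gamma at \<open>2 - b\<close>, while those of \<open>v\<close> carry
    the updated weights up to the normalizing gamma at \<open>b\<close>.\<close>
  define u where "u l = sqrt (w $ l * ?r l powr (2 - b))" for l
  define v where "v l = sqrt (w $ l * ?r l powr b) * ?q l" for l
  have uv: "u l * v l = w $ l * (?r l * ?q l)" for l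
  proof (cases "?r l = 0")
    case False
    then have "?r l powr (2 - b) * ?r l powr b = (?r l)\<^sup>2"
      using resid_nonneg[of x F P l] by (simp flip: powr_add)
    then have "(w $ l * ?r l powr (2 - b)) * (w $ l * ?r l powr b) = (w $ l * ?r l)\<^sup>2"
      by (simp add: power2_eq_square mult_ac)
    then show ?thesis
      using w[of l] resid_nonneg[of x F P l] by (simp add: u_def v_def flip: real_sqrt_mult mult.assoc)
  qed (simp add: u_def)
  have "dual_fun x F n w
      \<le> (\<Sum>l\<in>UNIV. w $ l * ((F (x l) - eval_mat P (x l)) \<bullet> (F (x l) - eval_mat Q (x l))))"
    using Q by (intro attains_dual_variational w P) (simp add: attains_dual_def)
  also have "\<dots> \<le> (\<Sum>l\<in>UNIV. u l * v l)"
    unfolding uv by (intro sum_mono mult_left_mono w) (simp add: resid_def norm_cauchy_schwarz)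
  finally have "(dual_fun x F n w)\<^sup>2 \<le> (\<Sum>l\<in>UNIV. u l * v l)\<^sup>2"
    using d by (intro power_mono) auto
  also have "\<dots> \<le> (\<Sum>l\<in>UNIV. (u l)\<^sup>2) * (\<Sum>l\<in>UNIV. (v l)\<^sup>2)"
    by (rule Cauchy_Schwarz_ineq_sum)
  also have "(\<Sum>l\<in>UNIV. (u l)\<^sup>2) = ?g (2 - b)"
    by (simp add: u_def lawson_gamma_def w)
  also have "(\<Sum>l\<in>UNIV. (v l)\<^sup>2) = ?g b * weighted_err x F ?w' Q"
    using lawson_gamma_pos[OF w P d, of b]
    by (simp add: v_def weighted_err_def sq_err_eq lawson_step_def power_mult_distrib w
        sum_distrib_left)
  also have "weighted_err x F ?w' Q = dual_fun x F n ?w'"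
    using Q by (simp add: attains_dual_def)
  finally show ?thesis by (simp add: lawson_nu_eq_gamma[OF w] mult_ac)
qed

lemma lawson_gamma_zeta_eq_sqrt_nu:
  assumes w: "\<And>l. 0 \<le> w $ l"
  shows "lawson_gamma x F w P b * lawson_zeta x F w P b = sqrt (lawson_nu x F w P b)"
proof -
  have "0 \<le> lawson_zeta x F w P b"
    unfolding lawson_zeta_def
    by (simp add: sum_nonneg sq_err_eq lawson_step_nonneg[OF w])
  then show ?thesis by (simp add: lawson_nu_def lawson_gamma_nonneg[OF w])
qed

lemma dual_fun_step_ge:
  fixes x :: "'m::finite \<Rightarrow> complex" and F :: "complex \<Rightarrow> complex^'t::finite^'s::finite"
  assumes w: "w \<in> simplex_weights" and P: "attains_dual x F n w P" and d: "dual_fun x F n w > 0"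
    and b: "b \<in> {0..2}"
  shows "dual_fun x F n w \<le> dual_fun x F n (lawson_step x F w P b)"
proof -
  let ?d = "dual_fun x F n w" and ?d' = "dual_fun x F n (lawson_step x F w P b)"
  have w0: "\<And>l. 0 \<le> w $ l" and w1: "(\<Sum>l\<in>UNIV. w $ l) = 1"
    using w by (auto simp: simplex_weights_def)
  \<comment> \<open>Only an inequality: nodes with zero residual contribute
    \<open>0 powr 0 = 0\<close> instead of their weight.\<close>
  have "lawson_gamma x F w P 0 \<le> (\<Sum>l\<in>UNIV. w $ l)"
    unfolding lawson_gamma_def by (intro sum_mono mult_left_le w0) (simp add: powr_def)
  then have "lawson_gamma x F w P 0 * ?d \<le> 1 * ?d"
    using d w1 by (intro mult_right_mono) auto
  moreover have "lawson_gamma x F w P 2 = ?d"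
    using P by (simp add: attains_dual_def weighted_err_eq_gamma)
  ultimately have nu: "lawson_nu x F w P b \<le> ?d"
    using lawson_nu_le_endpoint[OF w0 b, of x F P] by (simp add: lawson_nu_eq_gamma[OF w0])
  have sq: "?d\<^sup>2 \<le> lawson_nu x F w P b * ?d'"
    by (rule dual_fun_step_bound[OF w0 P d])
  have "lawson_nu x F w P b > 0"
    using lawson_gamma_pos[OF w0 P d] by (simp add: lawson_nu_eq_gamma[OF w0])
  moreover have "0 < lawson_nu x F w P b * ?d'"
    using less_le_trans[OF zero_less_power[OF d] sq] .
  \<comment> \<open>The sign of \<open>?d'\<close> is needed to multiply \<open>nu\<close> by
    it.\<close>
  ultimately have "?d' > 0" by (simp add: zero_less_mult_iff)
  then have "?d\<^sup>2 \<le> ?d * ?d'"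
    using sq nu by (meson order_trans mult_right_mono less_imp_le)
  then show ?thesis using d by (simp add: power2_eq_square)
qed

theorem proposition7p2:
  fixes x :: "'m::finite \<Rightarrow> complex"
    and F :: "complex \<Rightarrow> complex^'t::finite^'s::finite"
    and n :: "'s \<Rightarrow> 't \<Rightarrow> nat"
    and \<beta> :: real
    and w :: "nat \<Rightarrow> real^'m"
    and P :: "nat \<Rightarrow> complex poly^'t^'s"
  assumes nodes: "inj x"
    and num_nodes: "CARD('m) \<ge> (MAX (i, j)\<in>UNIV. n i j + 2)"
    and exponent: "\<beta> \<ge> 0"
    and run: "mdLawson_run x F n \<beta> w P"
    and dual_pos: "\<And>k. dual_fun x F n (w k) > 0"
    and support: "\<And>k. card {l. w k $ l \<noteq> 0} \<ge> max 1 (MAX (i, j)\<in>UNIV. n i j + 1)"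
  shows "(\<forall>k. convex_on UNIV (lawson_nu x F (w k) (P k)))
    \<and> (\<forall>k. is_arg_min (lawson_nu x F (w k) (P k)) (\<lambda>b. b \<ge> 0) 1
           \<and> (\<forall>b\<ge>0. sqrt (dual_fun x F n (lawson_step x F (w k) (P k) b))
                \<ge> dual_fun x F n (w k)
                  * (1 / (lawson_gamma x F (w k) (P k) b * lawson_zeta x F (w k) (P k) b)))
           \<and> is_arg_max (\<lambda>b. dual_fun x F n (w k)
                  * (1 / (lawson_gamma x F (w k) (P k) b * lawson_zeta x F (w k) (P k) b)))
               (\<lambda>b. b \<ge> 0) 1)
    \<and> (\<beta> \<in> {0..2} \<longrightarrow> (\<forall>k. dual_fun x F n (w (Suc k)) \<ge> dual_fun x F n (w k)))"
proof -
  have simplex: "w k \<in> simplex_weights" for k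
  proof (induction k)
    case (Suc k)
    then have w: "\<And>l. 0 \<le> w k $ l" by (simp add: simplex_weights_def)
    have "attains_dual x F n (w k) (P k)" "w (Suc k) = lawson_step x F (w k) (P k) \<beta>"
      using run by (simp_all add: mdLawson_run_def)
    then show ?case
      using lawson_step_simplex[OF w lawson_gamma_pos[OF w _ dual_pos]] by simp
  qed (use run in \<open>simp add: mdLawson_run_def\<close>)
  have w: "0 \<le> w k $ l" for k l
    using simplex[of k] by (simp add: simplex_weights_def)
  have P: "attains_dual x F n (w k) (P k)" for k
    using run by (simp add: mdLawson_run_def)
  let ?d = "\<lambda>k. dual_fun x F n (w k)" and ?nu = "\<lambda>k. lawson_nu x F (w k) (P k)"
  have nu_pos: "?nu k b > 0" for k b
    using lawson_gamma_pos[OF w P dual_pos] by (simp add: lawson_nu_eq_gamma[OF w])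
  have nu_min: "?nu k 1 \<le> ?nu k b" for k b
    by (rule lawson_nu_minimal[OF w])
  have lower: "?d k * (1 / sqrt (?nu k b)) \<le> sqrt (dual_fun x F n (lawson_step x F (w k) (P k) b))"
    for k b
  proof -
    have "?d k \<le> sqrt (?nu k b * dual_fun x F n (lawson_step x F (w k) (P k) b))"
      by (rule real_le_rsqrt[OF dual_fun_step_bound[OF w P dual_pos]])
    then show ?thesis using nu_pos[of k b] by (simp add: real_sqrt_mult field_simps)
  qed
  \<comment> \<open>The bound decreases as \<open>?nu\<close> grows, so the minimizer of
    \<open>?nu\<close> maximizes it; \<open>nu_pos\<close> keeps the quotients meaningful.\<close>
  have best: "?d k * (1 / sqrt (?nu k b)) \<le> ?d k * (1 / sqrt (?nu k 1))" for k b
    using dual_pos[of k] nu_pos nu_min by (intro mult_left_mono divide_left_mono) auto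
  show ?thesis
    unfolding lawson_gamma_zeta_eq_sqrt_nu[OF w]
  proof (intro conjI allI impI)
    fix k
    show "convex_on UNIV (?nu k)" by (rule convex_on_lawson_nu[OF w])
    show "is_arg_min (?nu k) (\<lambda>b. b \<ge> 0) 1"
      using nu_min by (auto simp: is_arg_min_linorder)
    show "is_arg_max (\<lambda>b. ?d k * (1 / sqrt (?nu k b))) (\<lambda>b. b \<ge> 0) 1"
      using best by (auto simp: is_arg_max_linorder)
    show "?d k * (1 / sqrt (?nu k b)) \<le> sqrt (dual_fun x F n (lawson_step x F (w k) (P k) b))"
      for b by (rule lower)
    assume "\<beta> \<in> {0..2}"
    then show "?d k \<le> ?d (Suc k)"
      using dual_fun_step_ge[OF simplex P dual_pos] run by (simp add: mdLawson_run_def)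
  qed
qed

end
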